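(* For any $p \ge 1$ and any $n$-point set $P$ in $\mathbb{R}^d$, there exists an embedding $f:\ell_p^d \to \ell_1^d$ with weak average distortion $D \lesssim p$ with respect to $P$, such that $f$ can be computed (from $P$) in time $\mathrm{poly}(nd)$, stored in $\mathrm{poly}(d)$ bits, and evaluated in time $\mathrm{poly}(d)$.
   Context: $\ell_p^d$ is $\mathbb{R}^d$ with $\|x\|_p$. $\|f\|_{\mathrm{Lip}}$ is the Lipschitz constant. For a metric space $\mathcal{M}$ and multiset $P$ of size $n$, $\Psi_\mathcal{M}(P,t)=|\{(x,y)\in P\times P:\mathrm{dist}_\mathcal{M}(x,y)>t\}|/n^2$. $f:\mathcal{M}\to\mathcal{N}$ has weak average distortion $D$ w.r.t. $P$ if $\sup_{t\ge0}t\,\Psi_\mathcal{N}(f(P),t)\ge\frac{\|f\|_{\mathrm{Lip}}}{D}\sup_{t\ge0}t\,\Psi_\mathcal{M}(P,t)$. $A\lesssim B$ means $A\le C_0B$ for an absolute constant $C_0$.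
   Formalization: The storage bound is poly(d) times the number of bits per coordinate of P, since poly(d) bits regardless of precision is impossible for arbitrary real points; time is counted in exact real arithmetic operations (including powers), with p and d known to the evaluator. *)

theory Defs
  imports "HOL-Analysis.Analysis" "HOL-Library.Multiset" "HOL-Computational_Algebra.Polynomial"
begin

section \<open>The spaces \<open>\<ell>\<^sub>p\<^sup>d\<close>\<close>

text \<open>The dimension is quantified inside the statement, so \<open>\<real>\<^sup>d\<close> is the set of real lists of length
  \<open>d\<close>, and \<open>\<ell>\<^sub>p\<^sup>d\<close> is an element of the library's type of metric spaces. The lemmas at the end of
  this section show that this is indeed a metric space, with the intended points and distance,
  for all \<open>p \<ge> 1\<close>.\<close>

definition vecs :: "nat \<Rightarrow> real list set" where
  "vecs d = {x. length x = d}"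

definition lp_norm :: "real \<Rightarrow> real list \<Rightarrow> real" where
  "lp_norm p x = (\<Sum>i<length x. \<bar>x ! i\<bar> powr p) powr (1 / p)"

definition lp_dist :: "real \<Rightarrow> real list \<Rightarrow> real list \<Rightarrow> real" where
  "lp_dist p x y = lp_norm p (map2 (-) x y)"

definition ell :: "real \<Rightarrow> nat \<Rightarrow> real list metric" where
  "ell p d = metric (vecs d, lp_dist p)"

lemma lp_dist_eq:
  assumes "x \<in> vecs d" "y \<in> vecs d"
  shows "lp_dist p x y = (\<Sum>i<d. \<bar>x ! i - y ! i\<bar> powr p) powr (1 / p)"
  using assms by (simp add: lp_dist_def lp_norm_def vecs_def)

lemma powr_convex_comb:
  fixes p u v x y :: real
  assumes "p \<ge> 1" "u \<ge> 0" "v \<ge> 0" "u + v = 1" "x \<ge> 0" "y \<ge> 0"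
  shows "(u * x + v * y) powr p \<le> u * x powr p + v * y powr p"
proof -
  have zero: "(w * z) powr p \<le> w * z powr p" if "0 \<le> w" "w \<le> 1" "0 \<le> z" for w z :: real
  proof -
    have "w powr p \<le> w"
    proof (cases "w = 0")
      case False
      then have "w powr p \<le> w powr 1"
        using that assms(1) by (intro powr_mono') auto
      then show ?thesis using that False by simp
    qed simp
    then have "w powr p * z powr p \<le> w * z powr p"
      by (intro mult_right_mono) auto
    then show ?thesis using that by (simp add: powr_mult)
  qed
  show ?thesis
  proof (cases "x = 0 \<or> y = 0")
    case True
    then show ?thesis
      using zero[of u x] zero[of v y] assms by auto
  next
    case False
    then have pos: "x \<in> {0<..}" "y \<in> {0<..}" using assms by auto
    have u: "u = 1 - v" and v: "0 \<le> v" "v \<le> 1" using assms by auto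
    show ?thesis
      using convex_onD[OF powr_convex[OF assms(1)] v pos] unfolding u by simp
  qed
qed

lemma minkowski_sum:
  fixes a b :: "nat \<Rightarrow> real"
  assumes p: "p \<ge> 1"
  shows "(\<Sum>i<d. \<bar>a i + b i\<bar> powr p) powr (1 / p)
         \<le> (\<Sum>i<d. \<bar>a i\<bar> powr p) powr (1 / p) + (\<Sum>i<d. \<bar>b i\<bar> powr p) powr (1 / p)"
proof -
  define S where "S f = (\<Sum>i<d. \<bar>f i\<bar> powr p)" for f :: "nat \<Rightarrow> real"
  define N where "N f = S f powr (1 / p)" for f
  have S0: "S f \<ge> 0" for f unfolding S_def by (intro sum_nonneg) auto
  have Np: "N f powr p = S f" for f
    using S0[of f] p by (simp add: N_def powr_powr)
  have N0: "N f \<ge> 0" for f by (simp add: N_def)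
  have zero: "\<bar>f i\<bar> = 0" if "N f = 0" "i < d" for f i
  proof -
    have "S f = 0" using Np[of f] that(1) p by simp
    then have "\<bar>f i\<bar> powr p = 0"
      using that(2) unfolding S_def by (subst (asm) sum_nonneg_eq_0_iff) auto
    then show ?thesis by simp
  qed
  have "N (\<lambda>i. a i + b i) \<le> N a + N b"
  proof (cases "N a = 0 \<or> N b = 0")
    case True
    then have "S (\<lambda>i. a i + b i) = S b \<or> S (\<lambda>i. a i + b i) = S a"
      using zero[of a] zero[of b] unfolding S_def by (auto intro!: sum.cong)
    then show ?thesis using N0[of a] N0[of b] unfolding N_def by (auto simp: N_def)
  next
    case False
    then have A: "N a > 0" "N b > 0" using N0[of a] N0[of b] by auto
    define T where "T = N a + N b"
    have T: "T > 0" using A by (simp add: T_def)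
    have one: "\<bar>a i + b i\<bar> powr p
        \<le> T powr p * (N a / T * (\<bar>a i\<bar> powr p / S a) + N b / T * (\<bar>b i\<bar> powr p / S b))" for i
    proof -
      have "\<bar>a i + b i\<bar> powr p \<le> (\<bar>a i\<bar> + \<bar>b i\<bar>) powr p"
        using p by (intro powr_mono2) auto
      also have "\<bar>a i\<bar> + \<bar>b i\<bar> = T * (N a / T * (\<bar>a i\<bar> / N a) + N b / T * (\<bar>b i\<bar> / N b))"
        using A T by (simp add: field_simps)
      also have "\<dots> powr p
          = T powr p * (N a / T * (\<bar>a i\<bar> / N a) + N b / T * (\<bar>b i\<bar> / N b)) powr p"
        using A T by (intro powr_mult)
      also have "(N a / T * (\<bar>a i\<bar> / N a) + N b / T * (\<bar>b i\<bar> / N b)) powr p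
          \<le> N a / T * (\<bar>a i\<bar> / N a) powr p + N b / T * (\<bar>b i\<bar> / N b) powr p"
        using A T p by (intro powr_convex_comb) (auto simp: T_def simp flip: add_divide_distrib)
      also have "(\<bar>a i\<bar> / N a) powr p = \<bar>a i\<bar> powr p / S a"
        using A by (simp add: powr_divide Np)
      also have "(\<bar>b i\<bar> / N b) powr p = \<bar>b i\<bar> powr p / S b"
        using A by (simp add: powr_divide Np)
      finally show ?thesis by (simp add: mult_left_mono)
    qed
    have SS: "S a > 0" "S b > 0" using A Np[of a] Np[of b] by (metis powr_gt_zero less_irrefl)+
    have "S (\<lambda>i. a i + b i)
        \<le> (\<Sum>i<d. T powr p * (N a / T * (\<bar>a i\<bar> powr p / S a) + N b / T * (\<bar>b i\<bar> powr p / S b)))"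
      unfolding S_def[of "\<lambda>i. a i + b i"] by (intro sum_mono one)
    also have "\<dots> = T powr p * (N a / T * (S a / S a) + N b / T * (S b / S b))"
      by (simp add: S_def sum.distrib flip: sum_distrib_left sum_divide_distrib)
    also have "\<dots> = T powr p"
      using SS T by (simp add: T_def flip: add_divide_distrib)
    finally have "N (\<lambda>i. a i + b i) \<le> (T powr p) powr (1 / p)"
      unfolding N_def using p S0 by (intro powr_mono2) auto
    also have "\<dots> = T" using T p by (simp add: powr_powr)
    finally show ?thesis by (simp add: T_def)
  qed
  then show ?thesis by (simp add: N_def S_def)
qed

lemma Metric_space_lp:
  assumes "p \<ge> 1"
  shows "Metric_space (vecs d) (lp_dist p)"
proof
  show "0 \<le> lp_dist p x y" for x y by (simp add: lp_dist_def lp_norm_def)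
  show "lp_dist p x y = lp_dist p y x" for x y
    by (simp add: lp_dist_def lp_norm_def min.commute abs_minus_commute)
  show "(lp_dist p x y = 0) = (x = y)" if "x \<in> vecs d" "y \<in> vecs d" for x y
  proof -
    have "lp_dist p x y = 0 \<longleftrightarrow> (\<Sum>i<d. \<bar>x ! i - y ! i\<bar> powr p) = 0"
      by (simp add: lp_dist_eq[OF that])
    also have "\<dots> \<longleftrightarrow> (\<forall>i<d. x ! i = y ! i)"
      by (subst sum_nonneg_eq_0_iff) auto
    also have "\<dots> \<longleftrightarrow> x = y" using that by (auto simp: vecs_def list_eq_iff_nth_eq)
    finally show ?thesis .
  qed
  show "lp_dist p x z \<le> lp_dist p x y + lp_dist p y z"
    if "x \<in> vecs d" "y \<in> vecs d" "z \<in> vecs d" for x y z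
    using minkowski_sum[OF assms, of "\<lambda>i. x ! i - y ! i" "\<lambda>i. y ! i - z ! i" d]
    by (simp add: lp_dist_eq[OF that(1,2)] lp_dist_eq[OF that(2,3)] lp_dist_eq[OF that(1,3)])
qed

lemma mspace_ell: "p \<ge> 1 \<Longrightarrow> mspace (ell p d) = vecs d"
  unfolding ell_def by (rule Metric_space.mspace_metric[OF Metric_space_lp])

lemma mdist_ell: "p \<ge> 1 \<Longrightarrow> mdist (ell p d) = lp_dist p"
  unfolding ell_def by (rule Metric_space.mdist_metric[OF Metric_space_lp])


section \<open>Weak average distortion\<close>

text \<open>The least Lipschitz constant; meaningful only if \<open>f\<close> is Lipschitz.\<close>

definition lip_const :: "'a metric \<Rightarrow> 'b metric \<Rightarrow> ('a \<Rightarrow> 'b) \<Rightarrow> real" where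
  "lip_const M N f =
     Inf {L. 0 \<le> L \<and> (\<forall>x\<in>mspace M. \<forall>y\<in>mspace M. mdist N (f x) (f y) \<le> L * mdist M x y)}"

text \<open>\<open>P \<times> P\<close>, with multiplicities.\<close>

definition mset_pairs :: "'a multiset \<Rightarrow> ('a \<times> 'a) multiset" where
  "mset_pairs P = (\<Sum>x\<in>#P. image_mset (Pair x) P)"

definition Psi :: "'a metric \<Rightarrow> 'a multiset \<Rightarrow> real \<Rightarrow> real" where
  "Psi M P t = real (size {#(x, y) \<in># mset_pairs P. mdist M x y > t#}) / (real (size P))\<^sup>2"

definition weak_avg_distortion ::
    "'a metric \<Rightarrow> 'b metric \<Rightarrow> ('a \<Rightarrow> 'b) \<Rightarrow> 'a multiset \<Rightarrow> real \<Rightarrow> bool" where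
  "weak_avg_distortion M N f P D \<longleftrightarrow>
     (SUP t\<in>{0..}. t * Psi N (image_mset f P) t)
       \<ge> lip_const M N f / D * (SUP t\<in>{0..}. t * Psi M P t)"


section \<open>A real RAM\<close>

text \<open>Unit-cost programs over natural-number registers, used for indexing and counting, and
  arrays of exact reals; a real variable is an array cell with a constant index. Besides field
  operations and comparisons there is the power operation \<open>\<bar>x\<bar>\<^sup>y\<close>, without which not even
  \<open>\<parallel>x\<parallel>\<^sub>p\<close> could be evaluated. Only integers are allowed as real constants in programs. There is no
  rounding, no conversion between naturals and reals, and no multiplication of naturals, as these
  would make unit-cost arithmetic unrealistically powerful.\<close>

datatype iexp = INum nat | IReg nat | IAdd iexp iexp | ISub iexp iexp

datatype rexp = RNum int | RCell nat iexp | RAdd rexp rexp | RSub rexp rexp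
  | RMul rexp rexp | RDiv rexp rexp | RPow rexp rexp

datatype bexp = ILess iexp iexp | RLess rexp rexp | BNot bexp | BAnd bexp bexp

datatype com = Skip | ISet nat iexp | RSet nat iexp rexp | Seq com com
  | Cond bexp com com | While bexp com

record mem =
  reg :: "nat \<Rightarrow> nat"
  arr :: "nat \<Rightarrow> nat \<Rightarrow> real"

primrec ival :: "iexp \<Rightarrow> mem \<Rightarrow> nat" where
  "ival (INum n) s = n"
| "ival (IReg r) s = reg s r"
| "ival (IAdd a b) s = ival a s + ival b s"
| "ival (ISub a b) s = ival a s - ival b s"

primrec rval :: "rexp \<Rightarrow> mem \<Rightarrow> real" where
  "rval (RNum k) s = of_int k"
| "rval (RCell a i) s = arr s a (ival i s)"
| "rval (RAdd a b) s = rval a s + rval b s"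
| "rval (RSub a b) s = rval a s - rval b s"
| "rval (RMul a b) s = rval a s * rval b s"
| "rval (RDiv a b) s = rval a s / rval b s"
| "rval (RPow a b) s = \<bar>rval a s\<bar> powr rval b s"

primrec bval :: "bexp \<Rightarrow> mem \<Rightarrow> bool" where
  "bval (ILess a b) s = (ival a s < ival b s)"
| "bval (RLess a b) s = (rval a s < rval b s)"
| "bval (BNot b) s = (\<not> bval b s)"
| "bval (BAnd b c) s = (bval b s \<and> bval c s)"

text \<open>\<open>exec c s t s'\<close>: started in \<open>s\<close>, program \<open>c\<close> terminates in \<open>s'\<close> after \<open>t\<close> steps, where a
  step is an assignment, a skip or the evaluation of a test. The expressions of a fixed program
  have bounded size, so charging for single operations would change \<open>t\<close> by a constant factor.\<close>

inductive exec :: "com \<Rightarrow> mem \<Rightarrow> nat \<Rightarrow> mem \<Rightarrow> bool" where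
  Skip: "exec Skip s 1 s"
| ISet: "exec (ISet r e) s 1 (s\<lparr>reg := (reg s)(r := ival e s)\<rparr>)"
| RSet: "exec (RSet a i e) s 1
           (s\<lparr>arr := (arr s)(a := (arr s a)(ival i s := rval e s))\<rparr>)"
| Seq: "exec c s t s' \<Longrightarrow> exec c' s' t' s'' \<Longrightarrow> exec (Seq c c') s (t + t') s''"
| CondTrue: "bval b s \<Longrightarrow> exec c s t s' \<Longrightarrow> exec (Cond b c c') s (1 + t) s'"
| CondFalse: "\<not> bval b s \<Longrightarrow> exec c' s t s' \<Longrightarrow> exec (Cond b c c') s (1 + t) s'"
| WhileFalse: "\<not> bval b s \<Longrightarrow> exec (While b c) s 1 s"
| WhileTrue: "bval b s \<Longrightarrow> exec c s t s' \<Longrightarrow> exec (While b c) s' t' s'' \<Longrightarrow>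
    exec (While b c) s (1 + t + t') s''"

text \<open>Input and output: initial registers and arrays are given by lists, everything else is 0.\<close>

definition init_mem :: "nat list \<Rightarrow> real list list \<Rightarrow> mem" where
  "init_mem ns rs =
     \<lparr>reg = (\<lambda>r. if r < length ns then ns ! r else 0),
      arr = (\<lambda>a i. if a < length rs \<and> i < length (rs ! a) then rs ! a ! i else 0)\<rparr>"

definition read_arr :: "mem \<Rightarrow> nat \<Rightarrow> nat \<Rightarrow> real list" where
  "read_arr s a m = map (arr s a) [0..<m]"


section \<open>Computing, storing and evaluating an embedding\<close>

text \<open>From \<open>n\<close>, \<open>d\<close>, \<open>p\<close> and the points \<open>xs\<close> (row by row), the program computes a list \<open>code\<close> of
  numbers in at most \<open>T\<close> steps; register 0 finally holds its length.\<close>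

definition computes_code ::
    "com \<Rightarrow> real \<Rightarrow> nat \<Rightarrow> real list list \<Rightarrow> real list \<Rightarrow> nat \<Rightarrow> bool" where
  "computes_code c p d xs code T \<longleftrightarrow>
     (\<exists>t s. exec c (init_mem [length xs, d] [[p], concat xs]) t s \<and> t \<le> T \<and>
        code = read_arr s 2 (reg s 0))"

text \<open>From \<open>d\<close>, \<open>p\<close>, the stored \<open>code\<close> and a point \<open>x\<close>, the program computes \<open>y\<close> in at most
  \<open>T\<close> steps.\<close>

definition evaluates ::
    "com \<Rightarrow> real \<Rightarrow> nat \<Rightarrow> real list \<Rightarrow> real list \<Rightarrow> real list \<Rightarrow> nat \<Rightarrow> bool" where
  "evaluates c p d code x y T \<longleftrightarrow>
     (\<exists>t s. exec c (init_mem [length code, d] [[p], code, x]) t s \<and> t \<le> T \<and>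
        y = read_arr s 3 d)"

text \<open>A format representing the numbers in \<open>W\<close> by bit strings of length \<open>b\<close>.\<close>

definition number_format :: "real set \<Rightarrow> (real \<Rightarrow> bool list) \<Rightarrow> nat \<Rightarrow> bool" where
  "number_format W enc b \<longleftrightarrow> inj_on enc W \<and> (\<forall>w\<in>W. length (enc w) = b)"

text \<open>Bit storage is relative to the precision of the data: whenever the coordinates of the points
  are representable with \<open>b\<close> bits each, so are all numbers in \<open>code\<close>, and the bit string storing
  \<open>code\<close> has length at most \<open>B * b\<close>. (No bound independent of \<open>b\<close> is possible, as the coordinates
  are arbitrary reals.) In particular, coordinates with \<open>poly(d)\<close> bits and \<open>B = poly(d)\<close> give
  \<open>poly(d)\<close> bits in total. As the format is arbitrary, \<open>code\<close> cannot hide information in numbers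
  of higher precision.\<close>

definition stored_in_bits :: "real list list \<Rightarrow> real list \<Rightarrow> nat \<Rightarrow> bool" where
  "stored_in_bits xs code B \<longleftrightarrow>
     (\<forall>W enc b. number_format W enc b \<and> set (concat xs) \<subseteq> W \<longrightarrow>
        set code \<subseteq> W \<and> length (concat (map enc code)) \<le> B * b)"

end

theory Submission
  imports Defs
begin

text \<open>Let \<open>z\<close> be the coordinatewise median of \<open>P\<close>. The embedding subtracts \<open>z\<close> and applies the
  homogeneous Mazur map, which sends \<open>u\<close> to the vector of all \<open>u\<^sub>i|u\<^sub>i|\<^bsup>p-1\<^esup> / \<parallel>u\<parallel>\<^bsup>p-1\<^esup>\<close>. This map
  turns the \<open>\<ell>\<^sub>p\<close> norm into the \<open>\<ell>\<^sub>1\<close> norm and is \<open>3p\<close>-Lipschitz by Young's and Hoelder's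
  inequalities. It preserves signs, so \<open>0\<close> is still a coordinatewise median of the image of \<open>P\<close>:
  in each coordinate, half of the points \<open>y\<close> lie on the other side of \<open>0\<close> than \<open>x\<close>. By a reverse
  Markov argument, a quarter of the points \<open>y\<close> satisfy \<open>\<parallel>f x - f y\<parallel>\<^sub>1 > \<parallel>x - z\<parallel>\<^sub>p / 4\<close>. On the other
  hand, \<open>\<parallel>x - y\<parallel>\<^sub>p > t\<close> implies that \<open>x\<close> or \<open>y\<close> is further than \<open>t / 2\<close> from \<open>z\<close>. The code of the
  embedding is \<open>z\<close>, whose coordinates are coordinates of input points.\<close>

section \<open>The homogeneous Mazur map\<close>

lemma powr_Young:
  fixes p a b :: real
  assumes "p \<ge> 1" "a \<ge> 0" "b \<ge> 0"
  shows "p * (a * b powr (p - 1)) \<le> a powr p + (p - 1) * b powr p"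
proof (cases "a = 0 \<or> b = 0")
  case True
  then show ?thesis using assms by auto
next
  case False
  \<comment> \<open>Weighted AM-GM for a^p and b^p with weights 1/p and 1 - 1/p. Multiplying by p
    afterwards avoids the conjugate exponent p/(p - 1), so p = 1 is included.\<close>
  have "a * b powr (p - 1) = (a powr p) powr (1 / p) * (b powr p) powr (1 - 1 / p)"
    using False assms by (simp add: powr_powr right_diff_distrib)
  also have "\<dots> \<le> 1 / p * a powr p + (1 - 1 / p) * b powr p"
    using False assms by (intro Youngs_inequality_0) auto
  finally have "p * (a * b powr (p - 1)) \<le> p * (1 / p * a powr p + (1 - 1 / p) * b powr p)"
    using assms by (intro mult_left_mono) auto
  also have "\<dots> = a powr p + (p - 1) * b powr p"
    using assms by (simp add: field_simps)
  finally show ?thesis .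
qed

lemma mult_powr_diff_one:
  fixes a p :: real
  assumes "a \<ge> 0"
  shows "a * a powr (p - 1) = a powr p"
  using assms by (cases "a = 0") (auto simp: powr_mult_base)

text \<open>Convexity: the tangent to t^p at a lies below the graph at b. This is Young's inequality
  with the roles of a and b exchanged.\<close>

lemma powr_diff_le:
  fixes p a b :: real
  assumes "p \<ge> 1" "0 \<le> b" "b \<le> a"
  shows "a powr p - b powr p \<le> p * ((a - b) * a powr (p - 1))"
proof -
  have "p * (b * a powr (p - 1)) \<le> b powr p + (p - 1) * a powr p"
    using assms by (intro powr_Young) auto
  moreover have "a * a powr (p - 1) = a powr p"
    using assms by (intro mult_powr_diff_one) auto
  ultimately show ?thesis by (simp add: algebra_simps)
qed

text \<open>For equal signs this is the tangent inequality; for opposite signs both |a| and |b| are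
  at most |a - b|. Keeping both weights makes the bound symmetric, and each weighted sum over
  coordinates then has the form treated by Hoelder's inequality.\<close>

lemma signed_powr_diff_le:
  fixes p a b :: real
  assumes p: "p \<ge> 1"
  shows "\<bar>a * \<bar>a\<bar> powr (p - 1) - b * \<bar>b\<bar> powr (p - 1)\<bar>
           \<le> p * (\<bar>a - b\<bar> * \<bar>a\<bar> powr (p - 1) + \<bar>a - b\<bar> * \<bar>b\<bar> powr (p - 1))"
    (is "\<bar>?\<phi> a - ?\<phi> b\<bar> \<le> ?R a b")
proof -
  have pos: "\<bar>?\<phi> a - ?\<phi> b\<bar> \<le> ?R a b" if "0 \<le> b" "b \<le> a" for a b
  proof -
    have "\<bar>?\<phi> a - ?\<phi> b\<bar> = a powr p - b powr p"
      using that p by (simp add: mult_powr_diff_one powr_mono2)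
    also have "\<dots> \<le> p * ((a - b) * a powr (p - 1))"
      using that p by (intro powr_diff_le)
    also have "\<dots> \<le> ?R a b"
      using that p by (intro mult_left_mono) auto
    finally show ?thesis .
  qed
  have mixed: "\<bar>?\<phi> a - ?\<phi> b\<bar> \<le> ?R a b" if "b \<le> 0" "0 \<le> a" for a b
  proof -
    have "\<bar>?\<phi> a - ?\<phi> b\<bar> \<le> \<bar>a\<bar> * \<bar>a\<bar> powr (p - 1) + \<bar>b\<bar> * \<bar>b\<bar> powr (p - 1)"
      by (intro order.trans[OF abs_triangle_ineq4]) (simp add: abs_mult)
    also have "\<dots> \<le> \<bar>a - b\<bar> * \<bar>a\<bar> powr (p - 1) + \<bar>a - b\<bar> * \<bar>b\<bar> powr (p - 1)"
      using that by (intro add_mono mult_right_mono) auto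
    also have "\<dots> \<le> ?R a b"
      using p mult_right_mono[of 1 p "\<bar>a - b\<bar> * \<bar>a\<bar> powr (p - 1) + \<bar>a - b\<bar> * \<bar>b\<bar> powr (p - 1)"]
      by simp
    finally show ?thesis .
  qed
  have sym: "?R a b = ?R b a" "\<bar>?\<phi> a - ?\<phi> b\<bar> = \<bar>?\<phi> b - ?\<phi> a\<bar>" for a b
    by (simp_all add: abs_minus_commute)
  have neg: "?R a b = ?R (-a) (-b)" "\<bar>?\<phi> a - ?\<phi> b\<bar> = \<bar>?\<phi> (-a) - ?\<phi> (-b)\<bar>" for a b
    by (simp_all add: abs_minus_commute)
  \<comment> \<open>Exchanging a and b and negating both reduce every sign pattern to
    \<open>pos\<close> or \<open>mixed\<close>.\<close>
  consider "0 \<le> b" "b \<le> a" | "0 \<le> a" "a \<le> b" | "b \<le> 0" "0 \<le> a" | "a \<le> 0" "0 \<le> b"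
    | "0 \<le> - b" "- b \<le> - a" | "0 \<le> - a" "- a \<le> - b"
    by linarith
  then show ?thesis
    by cases (metis pos mixed sym neg)+
qed

text \<open>Normalise both vectors to norm 1 and sum Young's inequality over the coordinates. The
  second factor is a power of the p-norm of u, not a norm with conjugate exponent, so that p = 1 is
  covered.\<close>

lemma Holder_sum:
  fixes p :: real and h u :: "nat \<Rightarrow> real"
  assumes p: "p \<ge> 1"
  shows "(\<Sum>i<d. \<bar>h i\<bar> * \<bar>u i\<bar> powr (p - 1))
    \<le> (\<Sum>i<d. \<bar>h i\<bar> powr p) powr (1 / p) * ((\<Sum>i<d. \<bar>u i\<bar> powr p) powr (1 / p)) powr (p - 1)"
proof -
  define S where "S f = (\<Sum>i<d. \<bar>f i\<bar> powr p)" for f :: "nat \<Rightarrow> real"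
  define N where "N f = S f powr (1 / p)" for f
  have S0: "S f \<ge> 0" for f unfolding S_def by (intro sum_nonneg) auto
  have N0: "N f \<ge> 0" for f by (simp add: N_def)
  have Np: "N f powr p = S f" for f
    using S0[of f] p by (simp add: N_def powr_powr)
  have zero: "f i = 0" if "N f = 0" "i < d" for f i
  proof -
    have "S f = 0" using Np[of f] that(1) p by simp
    then have "\<bar>f i\<bar> powr p = 0"
      using that(2) unfolding S_def by (subst (asm) sum_nonneg_eq_0_iff) auto
    then show ?thesis by simp
  qed
  have "(\<Sum>i<d. \<bar>h i\<bar> * \<bar>u i\<bar> powr (p - 1)) \<le> N h * N u powr (p - 1)"
  proof (cases "N h = 0 \<or> N u = 0")
    case True
    then have "(\<Sum>i<d. \<bar>h i\<bar> * \<bar>u i\<bar> powr (p - 1)) = 0"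
      using zero[of h] zero[of u] by (auto intro!: sum.neutral)
    then show ?thesis using N0 by simp
  next
    case False
    then have A: "N h > 0" "N u > 0" using N0[of h] N0[of u] by auto
    have "p * ((\<Sum>i<d. \<bar>h i\<bar> * \<bar>u i\<bar> powr (p - 1)) / (N h * N u powr (p - 1)))
        = (\<Sum>i<d. p * ((\<bar>h i\<bar> / N h) * (\<bar>u i\<bar> / N u) powr (p - 1)))"
      using A by (simp add: powr_divide sum_distrib_left sum_divide_distrib)
    also have "\<dots> \<le> (\<Sum>i<d. (\<bar>h i\<bar> / N h) powr p + (p - 1) * (\<bar>u i\<bar> / N u) powr p)"
      using A p by (intro sum_mono powr_Young) auto
    also have "\<dots> = S h / N h powr p + (p - 1) * (S u / N u powr p)"
      using A by (simp add: S_def powr_divide sum.distrib sum_distrib_left sum_divide_distrib)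
    \<comment> \<open>Each normalised sum of p-th powers is 1, so the total is 1 + (p - 1).\<close>
    also have "\<dots> = p * 1"
      using A by (simp flip: Np)
    finally have "(\<Sum>i<d. \<bar>h i\<bar> * \<bar>u i\<bar> powr (p - 1)) / (N h * N u powr (p - 1)) \<le> 1"
      using p by (subst (asm) mult_le_cancel_left_pos) auto
    then show ?thesis using A by (simp add: field_simps)
  qed
  then show ?thesis by (simp add: N_def S_def)
qed

text \<open>At the origin, division by zero yields 0.\<close>

definition mazur :: "real \<Rightarrow> real list \<Rightarrow> real list" where
  "mazur p u =
     map (\<lambda>a. a * \<bar>a\<bar> powr (p - 1) / (\<Sum>i<length u. \<bar>u ! i\<bar> powr p) powr (1 - 1 / p)) u"

section \<open>Norm identities and the Lipschitz bound\<close>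

lemma length_mazur [simp]: "length (mazur p u) = length u"
  by (simp add: mazur_def)

lemma powr_lp_norm:
  assumes "p \<ge> 1"
  shows "lp_norm p u powr p = (\<Sum>i<length u. \<bar>u ! i\<bar> powr p)"
  using assms by (simp add: lp_norm_def powr_powr sum_nonneg)

lemma lp_norm_nonneg: "0 \<le> lp_norm p u"
  by (simp add: lp_norm_def)

lemma lp_norm_eq_0D:
  assumes "p \<ge> 1" "lp_norm p u = 0" "i < length u"
  shows "u ! i = 0"
proof -
  have "(\<Sum>i<length u. \<bar>u ! i\<bar> powr p) = 0"
    using powr_lp_norm[OF assms(1), of u] assms(1,2) by simp
  then have "\<bar>u ! i\<bar> powr p = 0"
    using assms(3) by (subst (asm) sum_nonneg_eq_0_iff) auto
  then show ?thesis by simp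
qed

text \<open>Estimates need the normalising factor as a power of the norm, whereas
  \<open>mazur\<close> is defined by the formula that the program evaluates; the exponents agree as
  (1/p)(p - 1) = 1 - 1/p.\<close>

lemma nth_mazur:
  assumes "p \<ge> 1" "i < length u"
  shows "mazur p u ! i = u ! i * \<bar>u ! i\<bar> powr (p - 1) / lp_norm p u powr (p - 1)"
proof -
  have "1 / p * (p - 1) = 1 - 1 / p" using assms by (simp add: field_simps)
  then show ?thesis
    using assms(2) by (simp add: mazur_def lp_norm_def powr_powr)
qed

lemma abs_nth_mazur:
  assumes "p \<ge> 1" "i < length u"
  shows "\<bar>mazur p u ! i\<bar> = \<bar>u ! i\<bar> powr p / lp_norm p u powr (p - 1)"
  using mult_powr_diff_one[of "\<bar>u ! i\<bar>" p] by (simp add: nth_mazur[OF assms] abs_mult)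

text \<open>The numerators sum to the p-th power of the norm, and the denominator leaves one factor.
  At u = 0 both sides are 0.\<close>

lemma sum_abs_mazur:
  assumes "p \<ge> 1"
  shows "(\<Sum>i<length u. \<bar>mazur p u ! i\<bar>) = lp_norm p u"
proof -
  have "(\<Sum>i<length u. \<bar>mazur p u ! i\<bar>)
      = (\<Sum>i<length u. \<bar>u ! i\<bar> powr p) / lp_norm p u powr (p - 1)"
    by (simp add: abs_nth_mazur[OF assms] sum_divide_distrib)
  also have "\<dots> = lp_norm p u * lp_norm p u powr (p - 1) / lp_norm p u powr (p - 1)"
    by (simp add: powr_lp_norm[OF assms] mult_powr_diff_one[OF lp_norm_nonneg])
  finally show ?thesis by simp
qed

lemma lp_dist_1:
  assumes "length x = d" "length y = d"
  shows "lp_dist 1 x y = (\<Sum>i<d. \<bar>x ! i - y ! i\<bar>)"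
  using assms lp_dist_eq[of x d y 1] by (simp add: vecs_def sum_nonneg)

lemma lp_norm_triangle:
  assumes "p \<ge> 1" "length x = length y"
  shows "lp_norm p x \<le> lp_norm p y + lp_dist p x y"
  using minkowski_sum[OF assms(1), of "\<lambda>i. y ! i" "\<lambda>i. x ! i - y ! i" "length y"] assms(2)
  by (simp add: lp_norm_def lp_dist_def)

lemma lp_dist_commute: "lp_dist p x y = lp_dist p y x"
  by (simp add: lp_dist_def lp_norm_def min.commute abs_minus_commute)

lemma lp_dist_nonneg: "0 \<le> lp_dist p x y"
  by (simp add: lp_dist_def lp_norm_nonneg)

text \<open>Write \<open>\<phi>(t) = t|t|\<^bsup>p-1\<^esup>\<close> and \<open>a = \<parallel>x\<parallel> \<ge> b = \<parallel>y\<parallel>\<close>. The difference splits as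
  \<open>(\<phi>(x) - \<phi>(y)) / a\<^bsup>p-1\<^esup>\<close>, which Hoelder's inequality bounds, plus
  \<open>\<phi>(y) (1 / b\<^bsup>p-1\<^esup> - 1 / a\<^bsup>p-1\<^esup>)\<close>, whose \<open>\<ell>\<^sub>1\<close> norm is at most \<open>(a\<^bsup>p\<^esup> - b\<^bsup>p\<^esup>) / a\<^bsup>p-1\<^esup>\<close>.\<close>

lemma mazur_lipschitz_aux:
  assumes p: "p \<ge> 1" and len: "length x = d" "length y = d"
    and le: "lp_norm p y \<le> lp_norm p x"
  shows "lp_dist 1 (mazur p x) (mazur p y) \<le> 3 * p * lp_dist p x y"
proof (cases "lp_norm p y = 0")
  case True
  then have y0: "y ! i = 0" if "i < d" for i
    using lp_norm_eq_0D[OF p True] that len by simp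
  \<comment> \<open>The image of y is 0, so this distance is the l_1 norm of the image of x.\<close>
  have "lp_dist 1 (mazur p x) (mazur p y) = lp_norm p x"
    using len by (simp add: lp_dist_1[of _ d] nth_mazur p y0 flip: sum_abs_mazur)
  also have "\<dots> \<le> 1 * lp_dist p x y"
    using lp_norm_triangle[OF p, of x y] len True by simp
  also have "\<dots> \<le> 3 * p * lp_dist p x y"
    using p by (intro mult_right_mono lp_dist_nonneg) auto
  finally show ?thesis .
next
  case False
  define a b where "a = lp_norm p x" and "b = lp_norm p y"
  define \<phi> :: "real \<Rightarrow> real" where "\<phi> t = t * \<bar>t\<bar> powr (p - 1)" for t
  define D where "D = lp_dist p x y"
  have b: "b > 0" using False lp_norm_nonneg[of p y] by (simp add: b_def)
  have ab: "b \<le> a" using le by (simp add: a_def b_def)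
  have a: "a > 0" using b ab by simp
  have A: "a powr (p - 1) > 0" "b powr (p - 1) > 0" using a b by auto
  have mono: "b powr (p - 1) \<le> a powr (p - 1)" using p ab b by (intro powr_mono2) auto
  have D0: "D \<ge> 0" by (simp add: D_def lp_dist_nonneg)
  have D_eq: "D = (\<Sum>i<d. \<bar>x ! i - y ! i\<bar> powr p) powr (1 / p)"
    using len by (simp add: D_def lp_dist_eq[of _ d] vecs_def)
  have "\<bar>mazur p x ! i - mazur p y ! i\<bar>
      \<le> \<bar>\<phi> (x ! i) - \<phi> (y ! i)\<bar> / a powr (p - 1)
        + \<bar>\<phi> (y ! i)\<bar> * (1 / b powr (p - 1) - 1 / a powr (p - 1))" if "i < d" for i
  proof -
    have nn: "0 \<le> 1 / b powr (p - 1) - 1 / a powr (p - 1)"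
      using A mono by (simp add: field_simps)
    have "mazur p x ! i - mazur p y ! i = (\<phi> (x ! i) - \<phi> (y ! i)) / a powr (p - 1)
        - \<phi> (y ! i) * (1 / b powr (p - 1) - 1 / a powr (p - 1))"
      using that len by (simp add: nth_mazur p a_def b_def \<phi>_def algebra_simps diff_divide_distrib)
    also have "\<bar>\<dots>\<bar> \<le> \<bar>(\<phi> (x ! i) - \<phi> (y ! i)) / a powr (p - 1)\<bar>
        + \<bar>\<phi> (y ! i) * (1 / b powr (p - 1) - 1 / a powr (p - 1))\<bar>"
      by (rule abs_triangle_ineq4)
    finally show ?thesis using nn A by (simp add: abs_mult)
  qed
  then have "lp_dist 1 (mazur p x) (mazur p y)
      \<le> (\<Sum>i<d. \<bar>\<phi> (x ! i) - \<phi> (y ! i)\<bar> / a powr (p - 1)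
        + \<bar>\<phi> (y ! i)\<bar> * (1 / b powr (p - 1) - 1 / a powr (p - 1)))"
    using len by (subst lp_dist_1[of _ d]) (auto intro!: sum_mono)
  also have "\<dots> = (\<Sum>i<d. \<bar>\<phi> (x ! i) - \<phi> (y ! i)\<bar>) / a powr (p - 1)
        + (\<Sum>i<d. \<bar>\<phi> (y ! i)\<bar>) * (1 / b powr (p - 1) - 1 / a powr (p - 1))"
    by (simp add: sum.distrib sum_divide_distrib sum_distrib_right)
  \<comment> \<open>Hoelder's inequality, used once with weights from x and once with weights from
    y, gives 2p; the change of normalisation gives the remaining p.\<close>
  also have "\<dots> \<le> 2 * p * D + p * D"
  proof (rule add_mono)
    have "(\<Sum>i<d. \<bar>\<phi> (x ! i) - \<phi> (y ! i)\<bar>)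
        \<le> (\<Sum>i<d. p * (\<bar>x ! i - y ! i\<bar> * \<bar>x ! i\<bar> powr (p - 1)
             + \<bar>x ! i - y ! i\<bar> * \<bar>y ! i\<bar> powr (p - 1)))"
      unfolding \<phi>_def by (intro sum_mono signed_powr_diff_le p)
    also have "\<dots> = p * ((\<Sum>i<d. \<bar>x ! i - y ! i\<bar> * \<bar>x ! i\<bar> powr (p - 1))
        + (\<Sum>i<d. \<bar>x ! i - y ! i\<bar> * \<bar>y ! i\<bar> powr (p - 1)))"
      by (simp only: sum_distrib_left [symmetric] sum.distrib)
    also have "\<dots> \<le> p * (D * a powr (p - 1) + D * b powr (p - 1))"
      using p Holder_sum[OF p, of "\<lambda>i. x ! i - y ! i" "\<lambda>i. x ! i" d]
        Holder_sum[OF p, of "\<lambda>i. x ! i - y ! i" "\<lambda>i. y ! i" d] len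
      by (intro mult_left_mono add_mono) (auto simp: D_eq a_def b_def lp_norm_def)
    also have "\<dots> \<le> p * (D * a powr (p - 1) + D * a powr (p - 1))"
      using p D0 mono by (intro mult_left_mono add_mono) auto
    finally show "(\<Sum>i<d. \<bar>\<phi> (x ! i) - \<phi> (y ! i)\<bar>) / a powr (p - 1) \<le> 2 * p * D"
      using A by (simp add: field_simps)
  next
    have "(\<Sum>i<d. \<bar>\<phi> (y ! i)\<bar>) = (\<Sum>i<d. \<bar>y ! i\<bar> powr p)"
      by (simp add: \<phi>_def abs_mult mult_powr_diff_one)
    also have "\<dots> = b * b powr (p - 1)"
      using powr_lp_norm[OF p, of y] len mult_powr_diff_one[of b p] b by (simp add: b_def)
    finally have "(\<Sum>i<d. \<bar>\<phi> (y ! i)\<bar>) * (1 / b powr (p - 1) - 1 / a powr (p - 1))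
        = (b * a powr (p - 1) - b * b powr (p - 1)) / a powr (p - 1)"
      using a b by (simp add: field_simps)
    \<comment> \<open>Replacing one factor b by a turns the numerator into a^p - b^p, ready for the
      tangent inequality.\<close>
    also have "\<dots> \<le> (a * a powr (p - 1) - b * b powr (p - 1)) / a powr (p - 1)"
      using ab A by (intro divide_right_mono diff_right_mono mult_right_mono) auto
    also have "\<dots> = (a powr p - b powr p) / a powr (p - 1)"
      using a b by (simp add: mult_powr_diff_one)
    also have "\<dots> \<le> p * ((a - b) * a powr (p - 1)) / a powr (p - 1)"
      using ab b p by (intro divide_right_mono powr_diff_le) auto
    also have "\<dots> = p * (a - b)"
      using a by simp
    also have "\<dots> \<le> p * D"
      using lp_norm_triangle[OF p, of x y] len p by (simp add: a_def b_def D_def)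
    finally show "(\<Sum>i<d. \<bar>\<phi> (y ! i)\<bar>) * (1 / b powr (p - 1) - 1 / a powr (p - 1)) \<le> p * D" .
  qed
  finally show ?thesis by (simp add: D_def)
qed

lemma mazur_lipschitz:
  assumes "p \<ge> 1" "length x = d" "length y = d"
  shows "lp_dist 1 (mazur p x) (mazur p y) \<le> 3 * p * lp_dist p x y"
  using mazur_lipschitz_aux[OF assms] mazur_lipschitz_aux[OF assms(1,3,2)]
  by (metis lp_dist_commute linear)

section \<open>Distortion of the Mazur map centred at the median\<close>

lemma size_filter_mset_eq_sum: "size (filter_mset Q M) = (\<Sum>a\<in>#M. of_bool (Q a))"
  by (induction M) auto

lemma Psi_eq:
  "Psi M P t = (\<Sum>x\<in>#P. \<Sum>y\<in>#P. of_bool (t < mdist M x y)) / (real (size P))\<^sup>2"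
proof -
  \<comment> \<open>Only the first factor of the product is generalised to \<open>R\<close>;
    induction on \<open>P\<close> itself would change both.\<close>
  have "size (filter_mset (\<lambda>(x, y). t < mdist M x y) (\<Sum>x\<in>#R. image_mset (Pair x) P))
      = (\<Sum>x\<in>#R. \<Sum>y\<in>#P. of_bool (t < mdist M x y))" for R
    by (induction R) (simp_all add: size_filter_mset_eq_sum image_mset.compositionality o_def)
  then show ?thesis
    by (simp add: Psi_def mset_pairs_def image_mset.compositionality o_def)
qed

text \<open>Boundedness of the set under the supremum is Markov's inequality.\<close>

lemma le_SUP_Psi:
  assumes "t \<ge> 0"
  shows "t * Psi M P t \<le> (SUP t\<in>{0..}. t * Psi M P t)"
proof (rule cSUP_upper)
  show "bdd_above ((\<lambda>t. t * Psi M P t) ` {0..})"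
  proof (rule bdd_aboveI2)
    fix t :: real
    assume "t \<in> {0..}"
    then have "t * of_bool (t < mdist M x y) \<le> mdist M x y" for x y
      by auto
    then have "(\<Sum>x\<in>#P. \<Sum>y\<in>#P. t * of_bool (t < mdist M x y)) \<le> (\<Sum>x\<in>#P. \<Sum>y\<in>#P. mdist M x y)"
      by (intro sum_mset_mono)
    then show "t * Psi M P t \<le> (\<Sum>x\<in>#P. \<Sum>y\<in>#P. mdist M x y) / (real (size P))\<^sup>2"
      by (simp add: Psi_eq sum_mset_distrib_left divide_right_mono)
  qed
qed (use assms in auto)

text \<open>The strict inequality selects the smaller of two middle entries and makes the median
  unique. Membership keeps the centre's coordinates among the input numbers, and the two counts can
  be computed by comparisons alone.\<close>

definition is_lower_median :: "'a::linorder multiset \<Rightarrow> 'a \<Rightarrow> bool" where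
  "is_lower_median M m \<longleftrightarrow> m \<in># M \<and>
     2 * size {#a \<in># M. a < m#} < size M \<and> size M \<le> 2 * size {#a \<in># M. a \<le> m#}"

definition lower_median :: "'a::linorder multiset \<Rightarrow> 'a" where
  "lower_median M = (THE m. is_lower_median M m)"

lemma size_filter_mset_mono:
  assumes "\<And>a. a \<in># M \<Longrightarrow> Q a \<Longrightarrow> R a"
  shows "size (filter_mset Q M) \<le> size (filter_mset R M)"
  unfolding size_filter_mset_eq_sum using assms by (intro sum_mset_mono) auto

text \<open>If a < b were both medians, the entries up to a, at least half of all, would lie
  strictly below b, where fewer than half may lie.\<close>

lemma is_lower_median_unique:
  assumes "is_lower_median M m" "is_lower_median M m'"
  shows "m = m'"
proof -
  have False if "is_lower_median M a" "is_lower_median M b" "a < b" for a b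
    using that size_filter_mset_mono[of M "\<lambda>x. x \<le> a" "\<lambda>x. x < b"]
    unfolding is_lower_median_def by force
  then show ?thesis using assms by (metis linorder_cases)
qed

text \<open>The median is the least entry with at least half of \<open>M\<close> at or below
  it.\<close>

lemma is_lower_median_exists:
  assumes "M \<noteq> {#}"
  shows "\<exists>m. is_lower_median M m"
proof -
  define A where "A = {a \<in> set_mset M. size M \<le> 2 * size {#x \<in># M. x \<le> a#}}"
  define m where "m = Min A"
  have fin: "finite A" by (simp add: A_def)
  have "filter_mset (\<lambda>x. x \<le> Max (set_mset M)) M = M"
    by (simp add: filter_mset_eq_conv)
  then have "Max (set_mset M) \<in> A"
    using assms by (simp add: A_def)
  then have m: "m \<in> A" using fin unfolding m_def by (intro Min_in) auto
  have "2 * size {#x \<in># M. x < m#} < size M"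
  proof (cases "{#x \<in># M. x < m#} = {#}")
    case True
    show ?thesis using assms unfolding True by (simp add: nonempty_has_size)
  next
    case False
    \<comment> \<open>\<open>b\<close> is the largest entry below \<open>m\<close>. By minimality of
      \<open>m\<close>, fewer than half of the entries are at most \<open>b\<close>, and these
      include all entries below \<open>m\<close>.\<close>
    define b where "b = Max (set_mset {#x \<in># M. x < m#})"
    have b: "b \<in># {#x \<in># M. x < m#}"
      unfolding b_def using False by (intro Max_in) auto
    have "size {#x \<in># M. x < m#} \<le> size {#x \<in># M. x \<le> b#}"
      by (intro size_filter_mset_mono) (auto simp: b_def)
    moreover have "b \<notin> A"
      using b Min_le[OF fin, of b] unfolding m_def by auto
    ultimately show ?thesis using b by (auto simp: A_def)
  qed
  then show ?thesis using m by (auto simp: is_lower_median_def A_def)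
qed

lemma is_lower_median_iff:
  assumes "M \<noteq> {#}"
  shows "is_lower_median M m \<longleftrightarrow> m = lower_median M"
proof -
  have "\<exists>!m. is_lower_median M m"
    using is_lower_median_exists[OF assms] is_lower_median_unique by blast
  from theI'[OF this] show ?thesis
    unfolding lower_median_def using is_lower_median_unique by blast
qed

text \<open>For c \<ge> 0 the entries up to m suffice. For c < 0 those from m on suffice, since
  fewer than half lie below m. Entries equal to m count for either sign.\<close>

lemma half_opposite_median:
  fixes M :: "real multiset"
  assumes "is_lower_median M m"
  shows "size M \<le> 2 * size {#a \<in># M. (a - m) * c \<le> 0#}"
proof (cases "c \<ge> 0")
  case True
  then have "size {#a \<in># M. a \<le> m#} \<le> size {#a \<in># M. (a - m) * c \<le> 0#}"
    by (intro size_filter_mset_mono) (auto simp: mult_le_0_iff)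
  then show ?thesis using assms by (simp add: is_lower_median_def)
next
  case False
  then have "size {#a \<in># M. \<not> a < m#} \<le> size {#a \<in># M. (a - m) * c \<le> 0#}"
    by (intro size_filter_mset_mono) (auto simp: mult_le_0_iff)
  moreover have "size M = size {#a \<in># M. a < m#} + size {#a \<in># M. \<not> a < m#}"
    by (metis multiset_partition size_union)
  ultimately show ?thesis using assms by (simp add: is_lower_median_def)
qed

section \<open>Translation to the centre, and opposite coordinates\<close>

definition shift :: "real list \<Rightarrow> real list \<Rightarrow> real list" where
  "shift z x = map2 (-) x z"

lemma length_shift [simp]: "length (shift z x) = min (length x) (length z)"
  by (simp add: shift_def)

lemma nth_shift: "i < length x \<Longrightarrow> i < length z \<Longrightarrow> shift z x ! i = x ! i - z ! i"
  by (simp add: shift_def)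

lemma lp_dist_shift:
  assumes "length x = length z" "length y = length z"
  shows "lp_dist p (shift z x) (shift z y) = lp_dist p x y"
  using assms by (simp add: lp_dist_eq[of _ "length z"] vecs_def nth_shift)

lemma lp_norm_shift: "lp_norm p (shift z x) = lp_dist p x z"
  by (simp add: shift_def lp_dist_def)

text \<open>The Mazur map preserves signs, so opposite coordinates of \<open>u\<close> and \<open>v\<close> stay opposite.\<close>

lemma mazur_opposite:
  assumes "p \<ge> 1" "length u = d" "length v = d"
  shows "(\<Sum>i<d. of_bool (v ! i * u ! i \<le> 0) * \<bar>mazur p u ! i\<bar>)
           \<le> lp_dist 1 (mazur p u) (mazur p v)"
proof -
  have "of_bool (v ! i * u ! i \<le> 0) * \<bar>mazur p u ! i\<bar> \<le> \<bar>mazur p u ! i - mazur p v ! i\<bar>"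
    if "i < d" for i
  proof (cases "v ! i * u ! i \<le> 0")
    case True
    define r s where "r = \<bar>u ! i\<bar> powr (p - 1) / lp_norm p u powr (p - 1)"
      and "s = \<bar>v ! i\<bar> powr (p - 1) / lp_norm p v powr (p - 1)"
    have "mazur p u ! i = u ! i * r" "mazur p v ! i = v ! i * s" "r \<ge> 0" "s \<ge> 0"
      using that assms by (simp_all add: nth_mazur r_def s_def)
    moreover have "\<bar>b\<bar> \<le> \<bar>b - a\<bar>" if "a * b \<le> 0" for a b :: real
      using that by (auto simp: mult_le_0_iff)
    moreover have "(v ! i * s) * (u ! i * r) \<le> 0"
      using mult_nonpos_nonneg[OF True, of "s * r"] \<open>r \<ge> 0\<close> \<open>s \<ge> 0\<close> by (simp add: algebra_simps)
    ultimately show ?thesis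
      using True by simp
  qed simp
  then show ?thesis
    using assms by (subst lp_dist_1[of _ d]) (auto intro!: sum_mono simp del: sum_of_bool_mult_eq)
qed

text \<open>\<open>W v\<close> is the l_1 mass of the image of u on the coordinates where v is
  opposite to u. Each coordinate is opposite for half of the v, so \<open>W\<close> averages at
  least s/2. As \<open>W\<close> never exceeds s, and is at most s/4 unless v is far, a quarter of
  the v must be far.\<close>

lemma quarter_far:
  fixes U :: "real list multiset"
  assumes p: "p \<ge> 1" and len: "\<And>v. v \<in># U \<Longrightarrow> length v = d" and u: "length u = d"
    and half: "\<And>i c. i < d \<Longrightarrow> size U \<le> 2 * size {#v \<in># U. v ! i * c \<le> 0#}"
    and t: "lp_norm p u > t / 2" "t \<ge> 0"
  shows "real (size U) / 4 \<le> (\<Sum>v\<in>#U. of_bool (t / 8 < lp_dist 1 (mazur p u) (mazur p v)))"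
proof -
  define s where "s = lp_norm p u"
  define W where "W v = (\<Sum>i<d. of_bool (v ! i * u ! i \<le> 0) * \<bar>mazur p u ! i\<bar>)" for v :: "real list"
  have s: "s > 0" using t by (simp add: s_def)
  have s_eq: "s = (\<Sum>i<d. \<bar>mazur p u ! i\<bar>)"
    using sum_abs_mazur[OF p, of u] u by (simp add: s_def)
  have Ws: "W v \<le> s" for v
    unfolding W_def s_eq by (intro sum_mono) auto
  have W_le: "W v \<le> s / 4 + s * of_bool (t / 8 < lp_dist 1 (mazur p u) (mazur p v))"
    if "v \<in># U" for v
  proof (cases "t / 8 < lp_dist 1 (mazur p u) (mazur p v)")
    case True
    then show ?thesis using Ws[of v] s by simp
  next
    case False
    moreover have "W v \<le> lp_dist 1 (mazur p u) (mazur p v)"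
      unfolding W_def using mazur_opposite[OF p u len[OF that]] .
    \<comment> \<open>Here t/8 < s/4, because t/2 < s.\<close>
    ultimately show ?thesis using t by (simp add: s_def)
  qed
  have "real (size U) / 2 * s = (\<Sum>i<d. real (size U) / 2 * \<bar>mazur p u ! i\<bar>)"
    by (simp add: s_eq sum_distrib_left)
  also have "\<dots> \<le> (\<Sum>i<d. real (size {#v \<in># U. v ! i * u ! i \<le> 0#}) * \<bar>mazur p u ! i\<bar>)"
  proof (intro sum_mono mult_right_mono)
    fix i assume "i \<in> {..<d}"
    then have "real (size U) \<le> real (2 * size {#v \<in># U. v ! i * u ! i \<le> 0#})"
      using half by (intro of_nat_mono) auto
    then show "real (size U) / 2 \<le> real (size {#v \<in># U. v ! i * u ! i \<le> 0#})" by simp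
  qed auto
  also have "\<dots> = (\<Sum>v\<in>#U. W v)"
  proof -
    have "(\<Sum>v\<in>#R. W v) = (\<Sum>i<d. real (size {#v \<in># R. v ! i * u ! i \<le> 0#}) * \<bar>mazur p u ! i\<bar>)" for R
    proof (induction R)
      case (add v R)
      have "real (size {#w \<in># add_mset v R. w ! i * u ! i \<le> 0#})
          = of_bool (v ! i * u ! i \<le> 0) + real (size {#w \<in># R. w ! i * u ! i \<le> 0#})" for i
        by simp
      then show ?case
        using add.IH by (simp only: W_def distrib_right sum.distrib image_mset_add_mset sum_mset.add_mset)
    qed simp
    then show ?thesis by simp
  qed
  also have "\<dots> \<le> (\<Sum>v\<in>#U. s / 4 + s * of_bool (t / 8 < lp_dist 1 (mazur p u) (mazur p v)))"
    by (intro sum_mset_mono W_le)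
  also have "\<dots> = s * (real (size U) / 4
      + (\<Sum>v\<in>#U. of_bool (t / 8 < lp_dist 1 (mazur p u) (mazur p v))))"
    by (simp add: sum_mset.distrib sum_mset_distrib_left algebra_simps)
  finally have "s * (real (size U) / 2) \<le> \<dots>" by (simp add: mult.commute)
  then show ?thesis using s by (subst (asm) mult_le_cancel_left_pos) auto
qed

section \<open>The embedding, its Lipschitz constant and its distortion\<close>

definition centre :: "nat \<Rightarrow> real list multiset \<Rightarrow> real list" where
  "centre d P = map (\<lambda>j. lower_median (image_mset (\<lambda>x. x ! j) P)) [0..<d]"

definition embed :: "real \<Rightarrow> nat \<Rightarrow> real list multiset \<Rightarrow> real list \<Rightarrow> real list" where
  "embed p d P x = mazur p (shift (centre d P) x)"

lemma length_centre [simp]: "length (centre d P) = d"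
  by (simp add: centre_def)

lemma embed_dist_le:
  assumes "p \<ge> 1" "length x = d" "length y = d"
  shows "lp_dist 1 (embed p d P x) (embed p d P y) \<le> 3 * p * lp_dist p x y"
  using mazur_lipschitz[OF assms(1), of "shift (centre d P) x" d "shift (centre d P) y"] assms
  by (simp add: embed_def lp_dist_shift)

text \<open>A pair at distance above t has a member further than t/2 from the centre, so there are
  at most 2n such pairs per far point. Each far point has n/4 partners with image distance above
  t/8. The ratio of 2n to n/4 is 8.\<close>

lemma Psi_embed:
  assumes p: "p \<ge> 1" and P: "P \<noteq> {#}" "set_mset P \<subseteq> vecs d" and t: "t \<ge> 0"
  shows "Psi (ell p d) P t \<le> 8 * Psi (ell 1 d) (image_mset (embed p d P) P) (t / 8)"
proof -
  define z where "z = centre d P"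
  define n where "n = real (size P)"
  define U where "U = image_mset (shift z) P"
  define far :: "real list \<Rightarrow> real" where "far x = of_bool (t / 2 < lp_norm p (shift z x))" for x
  have z: "length z = d" by (simp add: z_def)
  have len: "length x = d" if "x \<in># P" for x using that P(2) by (auto simp: vecs_def)
  have half: "size U \<le> 2 * size {#v \<in># U. v ! i * c \<le> 0#}" if i: "i < d" for i c
  proof -
    define M where "M = image_mset (\<lambda>x. x ! i) P"
    have "is_lower_median M (z ! i)"
      using i P(1) by (simp add: is_lower_median_iff M_def z_def centre_def)
    then have "size M \<le> 2 * size {#a \<in># M. (a - z ! i) * c \<le> 0#}"
      by (rule half_opposite_median)
    moreover have "{#x \<in># P. (x ! i - z ! i) * c \<le> 0#} = {#x \<in># P. shift z x ! i * c \<le> 0#}"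
      using i z len by (intro filter_mset_cong) (auto simp: nth_shift)
    ultimately show ?thesis by (simp add: M_def U_def filter_mset_image_mset)
  qed
  have lower: "n / 4 * far x
      \<le> (\<Sum>y\<in>#P. of_bool (t / 8 < lp_dist 1 (embed p d P x) (embed p d P y)))" if "x \<in># P" for x
  proof (cases "t / 2 < lp_norm p (shift z x)")
    case True
    have "real (size U) / 4
        \<le> (\<Sum>v\<in>#U. of_bool (t / 8 < lp_dist 1 (mazur p (shift z x)) (mazur p v)))"
      using z len[OF that] by (intro quarter_far[of p U d] p half True t) (auto simp: U_def len)
    then show ?thesis
      using True by (simp add: far_def n_def U_def z_def embed_def image_mset.compositionality o_def)
  next
    case False
    have "0 \<le> (\<Sum>y\<in>#R. of_bool (Q y) :: real)" for Q :: "real list \<Rightarrow> bool" and R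
      by (induction R) auto
    then show ?thesis using False by (simp add: far_def)
  qed
  have upper: "of_bool (t < lp_dist p x y) \<le> far x + far y" if "x \<in># P" "y \<in># P" for x y
  proof -
    have "lp_dist p x y \<le> lp_norm p (shift z x) + lp_norm p (shift z y)"
      using Metric_space.triangle[OF Metric_space_lp[OF p], of x d z y] len z that
      by (simp add: lp_norm_shift vecs_def lp_dist_commute)
    then show ?thesis by (auto simp: far_def)
  qed
  have "(\<Sum>x\<in>#P. \<Sum>y\<in>#P. of_bool (t < lp_dist p x y)) \<le> (\<Sum>x\<in>#P. \<Sum>y\<in>#P. far x + far y)"
    by (intro sum_mset_mono upper)
  also have "\<dots> = 8 * (\<Sum>x\<in>#P. n / 4 * far x)"
    unfolding sum_mset_distrib_left [of "n / 4", symmetric]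
    by (simp add: sum_mset.distrib n_def flip: sum_mset_distrib_left)
  also have "\<dots> \<le> 8 * (\<Sum>x\<in>#P. \<Sum>y\<in>#P. of_bool (t / 8 < lp_dist 1 (embed p d P x) (embed p d P y)))"
    by (intro mult_left_mono sum_mset_mono lower) auto
  finally show ?thesis
    using p by (simp add: Psi_eq mdist_ell divide_right_mono image_mset.compositionality o_def)
qed

lemma Lipschitz_embed:
  assumes "p \<ge> 1"
  shows "Lipschitz_continuous_map (ell p d) (ell 1 d) (embed p d P)"
  unfolding Lipschitz_continuous_map_def
  using assms embed_dist_le[OF assms, of _ d]
  by (auto simp: mspace_ell mdist_ell vecs_def embed_def)

text \<open>The upper bound is the Lipschitz estimate. For positivity, the centre is sent to 0 and
  norms are preserved, so distances to the centre are kept exactly; hence every admissible constant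
  is at least 1.\<close>

lemma lip_const_embed:
  assumes p: "p \<ge> 1" and d: "d \<ge> 1"
  shows "0 < lip_const (ell p d) (ell 1 d) (embed p d P)"
    and "lip_const (ell p d) (ell 1 d) (embed p d P) \<le> 3 * p"
proof -
  define A where "A = {L. 0 \<le> L \<and> (\<forall>x\<in>vecs d. \<forall>y\<in>vecs d.
    lp_dist 1 (embed p d P x) (embed p d P y) \<le> L * lp_dist p x y)}"
  have lip: "lip_const (ell p d) (ell 1 d) (embed p d P) = Inf A"
    using p by (simp add: lip_const_def A_def mspace_ell mdist_ell)
  have mem: "3 * p \<in> A"
    using p embed_dist_le by (auto simp: A_def vecs_def)
  have "bdd_below A" by (auto simp: A_def intro!: bdd_belowI[of _ 0])
  then show "lip_const (ell p d) (ell 1 d) (embed p d P) \<le> 3 * p"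
    unfolding lip using mem by (rule cInf_lower[rotated])
  define z where "z = centre d P"
  \<comment> \<open>A point other than the centre; they differ because d \<ge> 1.\<close>
  define w where "w = map (\<lambda>a. a + 1) z"
  have len: "length z = d" "length w = d" by (auto simp: z_def w_def)
  have zw: "lp_dist p w z > 0"
    using Metric_space.mdist_pos_less[OF Metric_space_lp[OF p], of w z d] len d
    by (cases z) (auto simp: vecs_def w_def)
  have z0: "embed p d P z ! i = 0" if "i < d" for i
    using that p len by (simp add: embed_def nth_mazur nth_shift flip: z_def)
  have "lp_dist 1 (embed p d P w) (embed p d P z) = lp_dist p w z"
    using len z0 sum_abs_mazur[OF p, of "shift z w"]
    by (simp add: lp_dist_1[of _ d] lp_norm_shift embed_def flip: z_def)
  moreover have "lp_dist 1 (embed p d P w) (embed p d P z) \<le> L * lp_dist p w z" if "L \<in> A" for L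
    using that len by (simp add: A_def vecs_def)
  ultimately have "1 \<le> L" if "L \<in> A" for L
    using that mult_le_cancel_right_pos[OF zw, of 1 L] by simp
  then have "1 \<le> Inf A" using mem by (intro cInf_greatest) auto
  then show "0 < lip_const (ell p d) (ell 1 d) (embed p d P)" unfolding lip by simp
qed

text \<open>Passing from t to t/8 costs a factor 8 in the threshold and 8 in the count of pairs.
  With Lipschitz constant at most 3p this makes 8 * 8 * 3p = 192p.\<close>

lemma weak_avg_distortion_embed:
  assumes p: "p \<ge> 1" and d: "d \<ge> 1" and P: "P \<noteq> {#}" "set_mset P \<subseteq> vecs d"
  shows "weak_avg_distortion (ell p d) (ell 1 d) (embed p d P) P (192 * p)"
proof -
  let ?N = "SUP t\<in>{0..}. t * Psi (ell 1 d) (image_mset (embed p d P) P) t"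
  let ?M = "SUP t\<in>{0..}. t * Psi (ell p d) P t"
  have le: "t * Psi (ell p d) P t \<le> 64 * ?N" if "t \<ge> 0" for t
  proof -
    have "t * Psi (ell p d) P t \<le> t * (8 * Psi (ell 1 d) (image_mset (embed p d P) P) (t / 8))"
      using that by (intro mult_left_mono Psi_embed p P)
    also have "\<dots> = 64 * (t / 8 * Psi (ell 1 d) (image_mset (embed p d P) P) (t / 8))"
      by simp
    also have "\<dots> \<le> 64 * ?N"
      using that by (intro mult_left_mono le_SUP_Psi) auto
    finally show ?thesis .
  qed
  then have M: "?M \<le> 64 * ?N" by (intro cSUP_least) auto
  \<comment> \<open>The value at t = 0; the sign is needed to multiply the Lipschitz bound by the
    supremum.\<close>
  have "0 \<le> ?M" using le_SUP_Psi[of 0 "ell p d" P] by simp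
  have "lip_const (ell p d) (ell 1 d) (embed p d P) / (192 * p) * ?M \<le> 3 * p / (192 * p) * ?M"
    using p lip_const_embed[OF p d, of P] \<open>0 \<le> ?M\<close>
    by (intro mult_right_mono divide_right_mono) auto
  also have "\<dots> \<le> ?N" using p M by simp
  finally show ?thesis by (simp add: weak_avg_distortion_def)
qed

section \<open>Programs for the median and for the embedding\<close>

definition runs :: "com \<Rightarrow> mem \<Rightarrow> nat \<Rightarrow> (mem \<Rightarrow> bool) \<Rightarrow> bool" where
  "runs c s T Q \<longleftrightarrow> (\<exists>t s'. exec c s t s' \<and> t \<le> T \<and> Q s')"

lemma runs_mono:
  assumes "runs c s T Q" "T \<le> T'" "\<And>s'. Q s' \<Longrightarrow> Q' s'"
  shows "runs c s T' Q'"
  using assms unfolding runs_def by (meson order_trans)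

lemma runs_Skip: "Q s \<Longrightarrow> runs Skip s 1 Q"
  unfolding runs_def using exec.Skip by blast

lemma runs_ISet: "Q (s\<lparr>reg := (reg s)(r := ival e s)\<rparr>) \<Longrightarrow> runs (ISet r e) s 1 Q"
  unfolding runs_def using exec.ISet by blast

lemma runs_RSet:
  "Q (s\<lparr>arr := (arr s)(a := (arr s a)(ival i s := rval e s))\<rparr>) \<Longrightarrow> runs (RSet a i e) s 1 Q"
  unfolding runs_def using exec.RSet by blast

text \<open>The postcondition of the first command is the judgement about the second, so a program
  is processed without intermediate assertions.\<close>

lemma runs_Seq:
  assumes "runs c s T (\<lambda>s'. runs c' s' T' Q)"
  shows "runs (Seq c c') s (T + T') Q"
  using assms unfolding runs_def by (meson add_mono exec.Seq)

lemma runs_Cond: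
  assumes "bval b s \<Longrightarrow> runs c s T Q" "\<not> bval b s \<Longrightarrow> runs c' s T Q"
  shows "runs (Cond b c c') s (1 + T) Q"
  using assms unfolding runs_def by (meson add_left_mono exec.CondTrue exec.CondFalse)

text \<open>The invariant is indexed by the number of completed iterations, which is known in
  advance to end at \<open>n\<close>. Each iteration pays for one test and one body; the final 1 is
  the failing test.\<close>

lemma runs_While:
  assumes init: "I 0 s"
    and step: "\<And>k s. k < n \<Longrightarrow> I k s \<Longrightarrow> bval b s \<and> runs c s T (I (Suc k))"
    and exit: "\<And>s. I n s \<Longrightarrow> \<not> bval b s \<and> Q s"
  shows "runs (While b c) s (n * (1 + T) + 1) Q"
proof -
  have "runs (While b c) s ((n - k) * (1 + T) + 1) Q" if "k \<le> n" "I k s" for k s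
    using that
  proof (induction "n - k" arbitrary: k s)
    case 0
    then show ?case
      using exit[of s] exec.WhileFalse[of b s c] by (auto simp: runs_def)
  next
    case (Suc m)
    then have k: "k < n" and m: "m = n - Suc k" by auto
    obtain t s' where 1: "exec c s t s'" "t \<le> T" "I (Suc k) s'"
      using step[OF k Suc.prems(2)] by (auto simp: runs_def)
    obtain t' s'' where 2: "exec (While b c) s' t' s''" "t' \<le> (n - Suc k) * (1 + T) + 1" "Q s''"
      using Suc.hyps(1)[OF m _ 1(3)] k by (auto simp: runs_def)
    have "exec (While b c) s (1 + t + t') s''"
      using step[OF k Suc.prems(2)] 1(1) 2(1) by (intro exec.WhileTrue) auto
    moreover have "1 + t + t' \<le> (n - k) * (1 + T) + 1"
      using 1(2) 2(2) k by (simp flip: Suc_diff_Suc)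
    ultimately show ?case using 2(3) by (auto simp: runs_def)
  qed
  from this[of 0 s] init show ?thesis by simp
qed

lemmas runs_intros = runs_Skip runs_ISet runs_RSet runs_Seq runs_Cond

section \<open>The two programs and their running times\<close>

definition eval_prog :: com where
  "eval_prog =
     Seq (While (ILess (IReg 2) (IReg 1))
       (Seq (RSet 4 (INum 0) (RAdd (RCell 4 (INum 0))
               (RPow (RSub (RCell 2 (IReg 2)) (RCell 1 (IReg 2))) (RCell 0 (INum 0)))))
            (ISet 2 (IAdd (IReg 2) (INum 1)))))
     (Seq (ISet 2 (INum 0))
     (While (ILess (IReg 2) (IReg 1))
       (Seq (RSet 3 (IReg 2) (RDiv
               (RMul (RSub (RCell 2 (IReg 2)) (RCell 1 (IReg 2)))
                     (RPow (RSub (RCell 2 (IReg 2)) (RCell 1 (IReg 2)))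
                           (RSub (RCell 0 (INum 0)) (RNum 1))))
               (RPow (RCell 4 (INum 0)) (RSub (RNum 1) (RDiv (RNum 1) (RCell 0 (INum 0)))))))
            (ISet 2 (IAdd (IReg 2) (INum 1))))))"

text \<open>The first loop (invariant \<open>I\<close>) accumulates the sum of p-th powers in cell 0
  of array 4; the second (invariant \<open>J\<close>) writes the coordinates to array 3.\<close>

lemma runs_eval_prog:
  assumes s: "reg s 1 = d" "reg s 2 = 0" "arr s 0 0 = p" "arr s 1 = z" "arr s 2 = x" "arr s 4 0 = 0"
  shows "runs eval_prog s (6 * d + 3) (\<lambda>s. \<forall>j<d. arr s 3 j =
    (x j - z j) * \<bar>x j - z j\<bar> powr (p - 1) / (\<Sum>i<d. \<bar>x i - z i\<bar> powr p) powr (1 - 1 / p))"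
proof -
  define S where "S k = (\<Sum>i<k. \<bar>x i - z i\<bar> powr p)" for k
  define y where "y j = (x j - z j) * \<bar>x j - z j\<bar> powr (p - 1) / S d powr (1 - 1 / p)" for j
  define F where "F s \<longleftrightarrow> reg s 1 = d \<and> arr s 0 0 = p \<and> arr s 1 = z \<and> arr s 2 = x" for s :: mem
  define I where "I k s \<longleftrightarrow> F s \<and> reg s 2 = k \<and> arr s 4 0 = S k" for k and s :: mem
  define J where "J k s \<longleftrightarrow> F s \<and> reg s 2 = k \<and> arr s 4 0 = S d \<and> (\<forall>j<k. arr s 3 j = y j)" for k and s :: mem
  \<comment> \<open>\<open>RPow\<close> takes the absolute value of its base; this removes it from
    the sum.\<close>
  have S0: "S k \<ge> 0" for k unfolding S_def by (intro sum_nonneg) auto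
  \<comment> \<open>The bound has the nested shape in which the rules assemble it, so that they
    unify.\<close>
  have "runs eval_prog s ((d * (1 + (1 + 1)) + 1) + (1 + (d * (1 + (1 + 1)) + 1)))
    (\<lambda>s. \<forall>j<d. arr s 3 j = y j)"
    unfolding eval_prog_def
    apply (rule runs_Seq, rule runs_While[where I = I])
      apply (use s in \<open>simp add: I_def F_def S_def\<close>)
     apply (rule conjI, simp add: I_def F_def)
     apply (intro runs_intros)
     apply (simp add: I_def F_def S_def)
    apply (rule conjI, simp add: I_def F_def)
    apply (intro runs_intros)
    apply (rule runs_While[where I = J])
      apply (simp add: I_def J_def F_def)
     apply (rule conjI, simp add: J_def F_def)
     apply (intro runs_intros)
     apply (auto simp: J_def F_def y_def less_Suc_eq S0)
    done
  then show ?thesis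
    by (rule runs_mono) (simp_all add: y_def S_def)
qed

text \<open>Register 2 is the column; registers 3 and 4 hold the row and the array position of the
  candidate entry, registers 5 and 6 those of the entry compared with it. Registers 7 and 8 count
  the entries below, respectively not above, the candidate.\<close>

definition median_step :: com where
  "median_step =
     Seq (Cond (RLess (RCell 1 (IReg 6)) (RCell 1 (IReg 4))) (ISet 7 (IAdd (IReg 7) (INum 1))) Skip)
     (Seq (Cond (BNot (RLess (RCell 1 (IReg 4)) (RCell 1 (IReg 6))))
                (ISet 8 (IAdd (IReg 8) (INum 1))) Skip)
     (Seq (ISet 6 (IAdd (IReg 6) (IReg 1)))
          (ISet 5 (IAdd (IReg 5) (INum 1)))))"

text \<open>Positions advance by the row length \<open>d\<close>, and counts are doubled by
  addition, as naturals cannot be multiplied. Several rows may hold the median; each of them writes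
  the same value.\<close>

definition median_test :: com where
  "median_test =
     Seq (ISet 5 (INum 0)) (Seq (ISet 6 (IReg 2)) (Seq (ISet 7 (INum 0)) (Seq (ISet 8 (INum 0))
     (Seq (While (ILess (IReg 5) (IReg 0)) median_step)
     (Seq (Cond (BAnd (ILess (IAdd (IReg 7) (IReg 7)) (IReg 0))
                      (BNot (ILess (IAdd (IReg 8) (IReg 8)) (IReg 0))))
                (RSet 2 (IReg 2) (RCell 1 (IReg 4))) Skip)
     (Seq (ISet 4 (IAdd (IReg 4) (IReg 1)))
          (ISet 3 (IAdd (IReg 3) (INum 1)))))))))"

definition median_prog :: com where
  "median_prog =
     Seq (While (ILess (IReg 2) (IReg 1))
       (Seq (ISet 3 (INum 0)) (Seq (ISet 4 (IReg 2))
       (Seq (While (ILess (IReg 3) (IReg 0)) median_test)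
            (ISet 2 (IAdd (IReg 2) (INum 1)))))))
     (ISet 0 (IReg 1))"

text \<open>Column \<open>j\<close> of the input has the entries \<open>A (i * d + j)\<close>, and \<open>m j\<close> is its median.\<close>

lemma runs_median_prog:
  fixes A m :: "nat \<Rightarrow> real"
  assumes s: "reg s 0 = n" "reg s 1 = d" "reg s 2 = 0" "arr s 1 = A"
    and test: "\<And>i j. i < n \<Longrightarrow> j < d \<Longrightarrow>
      2 * (\<Sum>k<n. of_bool (A (k * d + j) < A (i * d + j))) < n \<and>
      n \<le> 2 * (\<Sum>k<n. of_bool (A (k * d + j) \<le> A (i * d + j))) \<longleftrightarrow> A (i * d + j) = m j"
    and ex: "\<And>j. j < d \<Longrightarrow> \<exists>i<n. A (i * d + j) = m j"
  shows "runs median_prog s (d * (7 * n\<^sup>2 + 10 * n + 5) + 2)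
    (\<lambda>s. reg s 0 = d \<and> (\<forall>j<d. arr s 2 j = m j))"
proof -
  define I where "I j s \<longleftrightarrow> reg s 0 = n \<and> reg s 1 = d \<and> reg s 2 = j \<and> arr s 1 = A
    \<and> (\<forall>j'<j. arr s 2 j' = m j')" for j and s :: mem
  \<comment> \<open>The last clause is conditional, as the first row holding the median may still
    lie ahead; \<open>ex\<close> discharges it after the last row.\<close>
  define J where "J j i s \<longleftrightarrow> I j s \<and> reg s 3 = i \<and> reg s 4 = i * d + j
    \<and> ((\<exists>i'<i. A (i' * d + j) = m j) \<longrightarrow> arr s 2 j = m j)" for j i and s :: mem
  define K where "K j i k s \<longleftrightarrow> J j i s \<and> reg s 5 = k \<and> reg s 6 = k * d + j
    \<and> reg s 7 = (\<Sum>k'<k. of_bool (A (k' * d + j) < A (i * d + j)))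
    \<and> reg s 8 = (\<Sum>k'<k. of_bool (A (k' * d + j) \<le> A (i * d + j)))" for j i k and s :: mem
  have step: "runs median_step s ((1 + 1) + ((1 + 1) + (1 + 1))) (K j i (Suc k))"
    if "K j i k s" for j i k s
    unfolding median_step_def using that
    by (intro runs_intros) (auto simp: K_def J_def I_def not_less)
  have test_step: "runs median_test s
      (1 + (1 + (1 + (1 + ((n * (1 + ((1 + 1) + ((1 + 1) + (1 + 1)))) + 1) + ((1 + 1) + (1 + 1)))))))
      (J j (Suc i))" if "J j i s" "i < n" "j < d" for j i s
    unfolding median_test_def
    apply (intro runs_intros runs_While[where I = "K j i"])
       apply (use that in \<open>simp add: K_def J_def I_def\<close>)
     apply (rule conjI)
      apply (simp add: K_def J_def I_def)
     apply (erule step)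
    apply (rule conjI)
     apply (simp add: K_def J_def I_def)
    apply (intro runs_intros)
     apply (use that test[OF that(2,3)] in \<open>auto simp: K_def J_def I_def less_Suc_eq not_less mult_2\<close>)
    done
  have "runs median_prog s ((d * (1 + (1 + (1 + ((n * (1 + (1 + (1 + (1 + (1 +
      ((n * (1 + ((1 + 1) + ((1 + 1) + (1 + 1)))) + 1) + ((1 + 1) + (1 + 1)))))))) + 1) + 1)))) + 1) + 1)
    (\<lambda>s. reg s 0 = d \<and> (\<forall>j<d. arr s 2 j = m j))"
    unfolding median_prog_def
    apply (rule runs_Seq, rule runs_While[where I = I])
      apply (use s in \<open>simp add: I_def\<close>)
     apply (rule conjI, simp add: I_def)
     subgoal for j s
       apply (intro runs_intros runs_While[where I = "J j"])
         apply (simp add: J_def I_def)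
        apply (rule conjI, simp add: J_def I_def)
        apply (erule (2) test_step)
       apply (rule conjI, simp add: J_def I_def)
       apply (intro runs_intros)
       apply (use ex[of j] in \<open>auto simp: J_def I_def less_Suc_eq\<close>)
       done
    apply (rule conjI, simp add: I_def)
    apply (intro runs_intros)
    apply (simp add: I_def)
    done
  then show ?thesis
    by (rule runs_mono) (simp_all add: power2_eq_square algebra_simps)
qed

section \<open>Input layout, and correctness of the stored code\<close>

lemma nth_concat_rows:
  assumes "\<And>x. x \<in> set xs \<Longrightarrow> length x = d" "i < length xs" "j < d"
  shows "concat xs ! (i * d + j) = xs ! i ! j" "i * d + j < length (concat xs)"
proof -
  have "concat xs ! (i * d + j) = xs ! i ! j \<and> i * d + j < length (concat xs)"
    using assms(1,2)
  proof (induction xs arbitrary: i)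
    case (Cons x xs)
    show ?case
    proof (cases i)
      case 0
      then show ?thesis using Cons.prems assms(3) by (simp add: nth_append)
    next
      case (Suc i')
      then show ?thesis
        using Cons.IH[of i'] Cons.prems by (simp add: nth_append)
    qed
  qed simp
  then show "concat xs ! (i * d + j) = xs ! i ! j" "i * d + j < length (concat xs)" by auto
qed

lemma size_filter_mset_nth:
  "size {#a \<in># image_mset f (mset xs). Q a#} = (\<Sum>i<length xs. of_bool (Q (f (xs ! i))))"
proof -
  have "size {#a \<in># image_mset f (mset xs). Q a#} = sum_list (map (\<lambda>x. of_bool (Q (f x))) xs)"
    by (simp add: size_filter_mset_eq_sum image_mset.compositionality o_def
        flip: sum_mset_sum_list)
  also have "\<dots> = (\<Sum>i<length xs. of_bool (Q (f (xs ! i))))"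
    by (simp only: sum_list_sum_nth length_map lessThan_atLeast0) (intro sum.cong, auto)
  finally show ?thesis .
qed

text \<open>A candidate is an entry of its column, so the two counts decide whether it is a lower
  median; by uniqueness only one value passes, and by existence some row holds it.\<close>

lemma computes_centre:
  assumes len: "\<And>x. x \<in> set xs \<Longrightarrow> length x = d" and xs: "xs \<noteq> []"
  shows "computes_code median_prog p d xs (centre d (mset xs))
    (d * (7 * (length xs)\<^sup>2 + 10 * length xs + 5) + 2)"
proof -
  define n where "n = length xs"
  define s where "s = init_mem [n, d] [[p], concat xs]"
  define A where "A = arr s 1"
  define m where "m j = centre d (mset xs) ! j" for j
  have A: "A (i * d + j) = xs ! i ! j" if "i < n" "j < d" for i j
    using nth_concat_rows[OF len, where i = i and j = j] that by (simp add: A_def s_def n_def init_mem_def)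
  have m: "is_lower_median (image_mset (\<lambda>x. x ! j) (mset xs)) a \<longleftrightarrow> a = m j" if "j < d" for a j
    using that xs by (simp add: is_lower_median_iff m_def centre_def)
  have column: "a \<in># image_mset (\<lambda>x. x ! j) (mset xs) \<longleftrightarrow> (\<exists>i<n. a = A (i * d + j))"
    if "j < d" for a j
  proof -
    have "(\<exists>i<n. a = A (i * d + j)) \<longleftrightarrow> (\<exists>i<length xs. a = xs ! i ! j)"
      using A that by (auto simp: n_def)
    also have "\<dots> \<longleftrightarrow> a \<in># image_mset (\<lambda>x. x ! j) (mset xs)"
      by (auto simp: set_conv_nth)
    finally show ?thesis ..
  qed
  have "runs median_prog s (d * (7 * n\<^sup>2 + 10 * n + 5) + 2)
    (\<lambda>s. reg s 0 = d \<and> (\<forall>j<d. arr s 2 j = m j))"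
  proof (rule runs_median_prog)
    show "reg s 0 = n" "reg s 1 = d" "reg s 2 = 0" by (simp_all add: s_def init_mem_def)
    show "arr s 1 = A" by (simp add: A_def)
    show "\<exists>i<n. A (i * d + j) = m j" if "j < d" for j
      using m[OF that, of "m j"] column[OF that, of "m j"] by (auto simp: is_lower_median_def)
    show "2 * (\<Sum>k<n. of_bool (A (k * d + j) < A (i * d + j))) < n \<and>
        n \<le> 2 * (\<Sum>k<n. of_bool (A (k * d + j) \<le> A (i * d + j))) \<longleftrightarrow> A (i * d + j) = m j"
      if "i < n" "j < d" for i j
    proof -
      have eq: "(\<Sum>k<n. of_bool (Q (A (k * d + j)))) = size {#a \<in># image_mset (\<lambda>x. x ! j) (mset xs). Q a#}"
        for Q
        unfolding size_filter_mset_nth using that by (auto simp: A n_def intro!: sum.cong)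
      have "A (i * d + j) \<in># image_mset (\<lambda>x. x ! j) (mset xs)"
        using column[OF that(2)] that(1) by blast
      moreover have "size (image_mset (\<lambda>x. x ! j) (mset xs)) = n"
        by (simp add: n_def)
      ultimately show ?thesis
        unfolding eq[of "\<lambda>a. a < A (i * d + j)"] eq[of "\<lambda>a. a \<le> A (i * d + j)"]
          m[OF that(2), symmetric] is_lower_median_def
        by (simp only: simp_thms)
    qed
  qed
  then obtain t s' where "exec median_prog s t s'" "t \<le> d * (7 * n\<^sup>2 + 10 * n + 5) + 2"
    "reg s' 0 = d" "\<forall>j<d. arr s' 2 j = m j"
    by (auto simp: runs_def)
  moreover from this have "centre d (mset xs) = read_arr s' 2 (reg s' 0)"
    by (auto simp: list_eq_iff_nth_eq read_arr_def m_def)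
  ultimately show ?thesis
    unfolding computes_code_def s_def n_def by blast
qed

lemma evaluates_embed:
  assumes "length x = d"
  shows "evaluates eval_prog p d (centre d P) x (embed p d P x) (6 * d + 3)"
proof -
  define z where "z = centre d P"
  have z: "length z = d" by (simp add: z_def)
  define s where "s = init_mem [length z, d] [[p], z, x]"
  define X Z where "X = arr s 2" and "Z = arr s 1"
  have X: "X i = x ! i" and Z: "Z i = z ! i" if "i < d" for i
    using that assms z by (simp_all add: X_def Z_def s_def init_mem_def)
  obtain t s' where s': "exec eval_prog s t s'" "t \<le> 6 * d + 3"
    "\<forall>j<d. arr s' 3 j = (X j - Z j) * \<bar>X j - Z j\<bar> powr (p - 1) /
       (\<Sum>i<d. \<bar>X i - Z i\<bar> powr p) powr (1 - 1 / p)"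
    using runs_eval_prog[of s d p Z X]
    by (auto simp: runs_def X_def Z_def) (auto simp: s_def init_mem_def)
  have "embed p d P x = read_arr s' 3 d"
    using s'(3) assms z
    by (auto simp: list_eq_iff_nth_eq read_arr_def embed_def mazur_def nth_shift X Z simp flip: z_def)
  then show ?thesis
    using s'(1,2) unfolding evaluates_def s_def z_def by blast
qed

text \<open>Every median is an input coordinate, so a format representing the data also represents
  the code, which consists of d words of b bits.\<close>

lemma stored_centre:
  assumes len: "\<And>x. x \<in> set xs \<Longrightarrow> length x = d" and xs: "xs \<noteq> []"
  shows "stored_in_bits xs (centre d (mset xs)) d"
proof -
  have "set (centre d (mset xs)) \<subseteq> set (concat xs)"
  proof
    fix a assume "a \<in> set (centre d (mset xs))"
    then obtain j where j: "j < d" "a = lower_median (image_mset (\<lambda>x. x ! j) (mset xs))"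
      by (auto simp: centre_def)
    then have "a \<in># image_mset (\<lambda>x. x ! j) (mset xs)"
      using is_lower_median_iff[of "image_mset (\<lambda>x. x ! j) (mset xs)" a] xs
      by (simp add: is_lower_median_def)
    then show "a \<in> set (concat xs)"
      using j(1) len by (force simp: in_set_conv_nth)
  qed
  moreover have "length (concat (map enc ws)) = length ws * b"
    if "number_format W enc b" "set ws \<subseteq> W" for W enc b ws
    using that(2) by (induction ws) (use that(1) in \<open>auto simp: number_format_def\<close>)
  ultimately show ?thesis
    unfolding stored_in_bits_def by (auto dest: subset_trans)
qed

theorem theorem5p10:
  shows "\<exists>(C\<^sub>0::real) (Prep::com) (Eval::com) (q\<^sub>1::nat poly) (q\<^sub>2::nat poly) (q\<^sub>3::nat poly).
    \<forall>(p::real) (d::nat) (n::nat) (P::real list multiset).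
      p \<ge> 1 \<longrightarrow> d \<ge> 1 \<longrightarrow> n \<ge> 1 \<longrightarrow> size P = n \<longrightarrow> set_mset P \<subseteq> mspace (ell p d) \<longrightarrow>
      (\<exists>(f :: real list \<Rightarrow> real list) (D::real).
         Lipschitz_continuous_map (ell p d) (ell 1 d) f \<and> lip_const (ell p d) (ell 1 d) f > 0 \<and>
         0 < D \<and> D \<le> C\<^sub>0 * p \<and> weak_avg_distortion (ell p d) (ell 1 d) f P D \<and>
         (\<forall>xs. mset xs = P \<longrightarrow>
            (\<exists>code. computes_code Prep p d xs code (poly q\<^sub>1 (n * d)) \<and>
               stored_in_bits xs code (poly q\<^sub>2 d) \<and>
               (\<forall>x\<in>mspace (ell p d). evaluates Eval p d code x (f x) (poly q\<^sub>3 d)))))"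
proof (rule exI[of _ 192], rule exI[of _ median_prog], rule exI[of _ eval_prog],
    rule exI[of _ "[:2, 15, 7:]"], rule exI[of _ "[:0, 1:]"], rule exI[of _ "[:3, 6:]"],
    intro allI impI)
  fix p :: real and d n :: nat and P :: "real list multiset"
  assume p: "p \<ge> 1" and d: "d \<ge> 1" and n: "n \<ge> 1" "size P = n"
    and sub: "set_mset P \<subseteq> mspace (ell p d)"
  have P: "P \<noteq> {#}" "set_mset P \<subseteq> vecs d" using n sub p by (auto simp: mspace_ell)
  show "\<exists>f D. Lipschitz_continuous_map (ell p d) (ell 1 d) f \<and>
      lip_const (ell p d) (ell 1 d) f > 0 \<and>
      0 < D \<and> D \<le> 192 * p \<and> weak_avg_distortion (ell p d) (ell 1 d) f P D \<and>
      (\<forall>xs. mset xs = P \<longrightarrow>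
         (\<exists>code. computes_code median_prog p d xs code (poly [:2, 15, 7:] (n * d)) \<and>
            stored_in_bits xs code (poly [:0, 1:] d) \<and>
            (\<forall>x\<in>mspace (ell p d). evaluates eval_prog p d code x (f x) (poly [:3, 6:] d))))"
  \<comment> \<open>The embedding depends on the multiset only, so it is fixed before an ordering
    \<open>xs\<close> of the points is given.\<close>
  proof (intro exI[of _ "embed p d P"] exI[of _ "192 * p"] conjI allI impI)
    fix xs assume xs: "mset xs = P"
    have len: "length x = d" if "x \<in> set xs" for x
      using that P(2) xs by (auto simp: vecs_def)
    have ne: "xs \<noteq> []" and size: "length xs = n"
      using xs P(1) n by auto
    \<comment> \<open>The running time becomes a polynomial in n * d alone: n and d are at least 1,
      and the linear coefficient 15 is 10 + 5.\<close>
    have "n\<^sup>2 * d \<le> (n * d)\<^sup>2" "d \<le> n * d"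
      using d n(1) by (auto simp: power2_eq_square)
    moreover have "d * (7 * n\<^sup>2 + 10 * n + 5) + 2 = 7 * (n\<^sup>2 * d) + 10 * (n * d) + 5 * d + 2"
      by (simp add: algebra_simps)
    moreover have "poly [:2, 15, 7:] (n * d) = 7 * (n * d)\<^sup>2 + 15 * (n * d) + 2"
      by (simp add: power2_eq_square algebra_simps)
    ultimately have "d * (7 * n\<^sup>2 + 10 * n + 5) + 2 \<le> poly [:2, 15, 7:] (n * d)"
      by linarith
    then have "computes_code median_prog p d xs (centre d P) (poly [:2, 15, 7:] (n * d))"
      using computes_centre[OF len ne, of p] unfolding computes_code_def size xs
      by (meson order_trans)
    moreover have "stored_in_bits xs (centre d P) (poly [:0, 1:] d)"
      using stored_centre[OF len ne] xs by simp
    moreover have "evaluates eval_prog p d (centre d P) x (embed p d P x) (poly [:3, 6:] d)"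
      if "x \<in> mspace (ell p d)" for x
      using evaluates_embed[of x d p P] that p by (simp add: mspace_ell vecs_def mult.commute add.commute)
    ultimately show "\<exists>code. computes_code median_prog p d xs code (poly [:2, 15, 7:] (n * d)) \<and>
        stored_in_bits xs code (poly [:0, 1:] d) \<and>
        (\<forall>x\<in>mspace (ell p d). evaluates eval_prog p d code x (embed p d P x) (poly [:3, 6:] d))"
      by blast
  qed (use p d P in \<open>simp_all add: Lipschitz_embed lip_const_embed weak_avg_distortion_embed\<close>)
qed

end
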